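(* Let $(A,[-,-],[-,-,-],\varepsilon)$ be a color Akivis algebra and $\beta:A\to A$ an even endomorphism. Put $[-,-]_{\beta^0}:=[-,-]$, $[-,-,-]_{\beta^0}:=[-,-,-]$ and define recursively, for every integer $n\ge 1$ and all $x,y,z\in\mathcal H(A)$, $$[x,y]_{\beta^n}:=\beta([x,y]_{\beta^{n-1}}),\qquad [x,y,z]_{\beta^n}:=\beta^2([x,y,z]_{\beta^{n-1}}).$$ Then $(A,[-,-]_{\beta^n},[-,-,-]_{\beta^n},\varepsilon,\beta^n)$ is a multiplicative color Hom-Akivis algebra for every $n\ge1$.
   Context: $\mathbf K$ is a field of characteristic $0$ and $G$ is an abelian group (written additively). For a $G$-graded vector space $V=\bigoplus_{a\in G}V_a$, $\mathcal H(V)$ is the set of homogeneous elements. A linear (or multilinear) map is even if it preserves degrees. A bicharacter is a map $\varepsilon:G\times G\to\mathbf K^*$ with $\varepsilon(a,b)\varepsilon(b,a)=1$, $\varepsilon(a,b+c)=\varepsilon(a,b)\varepsilon(a,c)$, $\varepsilon(a+b,c)=\varepsilon(a,c)\varepsilon(b,c)$. For homogeneous $x,y$ of degrees $a,b$ one writes $\varepsilon(x,y):=\varepsilon(a,b)$. A color Hom-Akivis algebra is a quintuple $(A,[-,-],[-,-,-],\varepsilon,\alpha_A)$ consisting of a $G$-graded vector space $A$, a bicharacter $\varepsilon$, an even bilinear map $[-,-]$ that is $\varepsilon$-skew-symmetric ($[x,y]=-\varepsilon(x,y)[y,x]$ for homogeneous $x,y$), an even trilinear map $[-,-,-]$, and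 an even linear map $\alpha_A:A\to A$ such that for all $x,y,z\in\mathcal H(A)$ $$\oint\varepsilon(z,x)[[x,y],\alpha_A(z)]=\oint\varepsilon(z,x)\big([x,y,z]-\varepsilon(x,y)[y,x,z]\big),$$ where $\oint$ denotes the sum over cyclic permutations of $x,y,z$. It is multiplicative if in addition $\alpha_A$ is an endomorphism with respect to both $[-,-]$ and $[-,-,-]$. A color Akivis algebra is a color Hom-Akivis algebra with $\alpha_A=\mathrm{Id}_A$. An even endomorphism $\beta$ of $A$ is an even linear map with $\beta([x,y])=[\beta(x),\beta(y)]$ and $\beta([x,y,z])=[\beta(x),\beta(y),\beta(z)]$. *)

theory Defs
  imports Complex_Main
begin

text \<open>A zero vector lies in every homogeneous component, so the degree of a homogeneous element is
  not a function of it. Identities "for homogeneous \<open>x, y\<close>" are therefore quantified over degrees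
  \<open>a, b\<close> and \<open>x \<in> V a\<close>, \<open>y \<in> V b\<close>, with \<open>\<epsilon>(x, y)\<close> written \<open>\<epsilon> a b\<close>.\<close>

locale graded_vector_space = vector_space scale
  for scale :: "'k::field_char_0 \<Rightarrow> 'v::ab_group_add \<Rightarrow> 'v" (infixr "*s" 75) +
  fixes V :: "'g::ab_group_add \<Rightarrow> 'v set"
  assumes subspace_component: "subspace (V a)"
    and direct_sum:
      "\<exists>!f. (\<forall>a. f a \<in> V a) \<and> finite {a. f a \<noteq> 0} \<and> x = (\<Sum>a | f a \<noteq> 0. f a)"
begin

definition even_linear :: "('v \<Rightarrow> 'v) \<Rightarrow> bool" where
  "even_linear f \<longleftrightarrow> Vector_Spaces.linear scale scale f \<and> (\<forall>a. \<forall>x\<in>V a. f x \<in> V a)"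

definition even_bilinear :: "('v \<Rightarrow> 'v \<Rightarrow> 'v) \<Rightarrow> bool" where
  "even_bilinear f \<longleftrightarrow>
     (\<forall>y. Vector_Spaces.linear scale scale (\<lambda>x. f x y)) \<and>
     (\<forall>x. Vector_Spaces.linear scale scale (\<lambda>y. f x y)) \<and>
     (\<forall>a b. \<forall>x\<in>V a. \<forall>y\<in>V b. f x y \<in> V (a + b))"

definition even_trilinear :: "('v \<Rightarrow> 'v \<Rightarrow> 'v \<Rightarrow> 'v) \<Rightarrow> bool" where
  "even_trilinear f \<longleftrightarrow>
     (\<forall>y z. Vector_Spaces.linear scale scale (\<lambda>x. f x y z)) \<and>
     (\<forall>x z. Vector_Spaces.linear scale scale (\<lambda>y. f x y z)) \<and>
     (\<forall>x y. Vector_Spaces.linear scale scale (\<lambda>z. f x y z)) \<and>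
     (\<forall>a b c. \<forall>x\<in>V a. \<forall>y\<in>V b. \<forall>z\<in>V c. f x y z \<in> V (a + b + c))"

end

locale bicharacter =
  fixes \<epsilon> :: "'g::ab_group_add \<Rightarrow> 'g \<Rightarrow> 'k::field_char_0"
  assumes nonzero: "\<epsilon> a b \<noteq> 0"
    and swap: "\<epsilon> a b * \<epsilon> b a = 1"
    and add_right: "\<epsilon> a (b + c) = \<epsilon> a b * \<epsilon> a c"
    and add_left: "\<epsilon> (a + b) c = \<epsilon> a c * \<epsilon> b c"

locale color_hom_akivis_algebra = graded_vector_space scale V + bicharacter \<epsilon>
  for scale :: "'k::field_char_0 \<Rightarrow> 'v::ab_group_add \<Rightarrow> 'v" (infixr "*s" 75)
    and V :: "'g::ab_group_add \<Rightarrow> 'v set"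
    and br :: "'v \<Rightarrow> 'v \<Rightarrow> 'v"
    and tr :: "'v \<Rightarrow> 'v \<Rightarrow> 'v \<Rightarrow> 'v"
    and \<epsilon> :: "'g \<Rightarrow> 'g \<Rightarrow> 'k"
    and \<alpha> :: "'v \<Rightarrow> 'v" +
  assumes even_bilinear_br: "even_bilinear br"
    and skew_symmetric: "x \<in> V a \<Longrightarrow> y \<in> V b \<Longrightarrow> br x y = - (\<epsilon> a b *s br y x)"
    and even_trilinear_tr: "even_trilinear tr"
    and even_linear_twist: "even_linear \<alpha>"
    and hom_akivis_identity: "x \<in> V a \<Longrightarrow> y \<in> V b \<Longrightarrow> z \<in> V c \<Longrightarrow>
        \<epsilon> c a *s br (br x y) (\<alpha> z) + \<epsilon> a b *s br (br y z) (\<alpha> x) + \<epsilon> b c *s br (br z x) (\<alpha> y)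
      = \<epsilon> c a *s (tr x y z - \<epsilon> a b *s tr y x z)
      + \<epsilon> a b *s (tr y z x - \<epsilon> b c *s tr z y x)
      + \<epsilon> b c *s (tr z x y - \<epsilon> c a *s tr x z y)"

locale multiplicative_color_hom_akivis_algebra = color_hom_akivis_algebra +
  assumes twist_br: "\<alpha> (br x y) = br (\<alpha> x) (\<alpha> y)"
    and twist_tr: "\<alpha> (tr x y z) = tr (\<alpha> x) (\<alpha> y) (\<alpha> z)"

locale color_akivis_algebra = color_hom_akivis_algebra scale V br tr \<epsilon> id
  for scale :: "'k::field_char_0 \<Rightarrow> 'v::ab_group_add \<Rightarrow> 'v" (infixr "*s" 75)
    and V :: "'g::ab_group_add \<Rightarrow> 'v set"
    and br :: "'v \<Rightarrow> 'v \<Rightarrow> 'v"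
    and tr :: "'v \<Rightarrow> 'v \<Rightarrow> 'v \<Rightarrow> 'v"
    and \<epsilon> :: "'g \<Rightarrow> 'g \<Rightarrow> 'k"
begin

definition even_endomorphism :: "('v \<Rightarrow> 'v) \<Rightarrow> bool" where
  "even_endomorphism \<beta> \<longleftrightarrow> even_linear \<beta> \<and>
     (\<forall>x y. \<beta> (br x y) = br (\<beta> x) (\<beta> y)) \<and>
     (\<forall>x y z. \<beta> (tr x y z) = tr (\<beta> x) (\<beta> y) (\<beta> z))"

end

text \<open>The recursions are imposed on all vectors; for linear \<open>\<beta>\<close> and multilinear brackets this gives
  the multilinear extension of the same recursions on homogeneous vectors.\<close>

primrec twisted_br :: "('v \<Rightarrow> 'v) \<Rightarrow> ('v \<Rightarrow> 'v \<Rightarrow> 'v) \<Rightarrow> nat \<Rightarrow> 'v \<Rightarrow> 'v \<Rightarrow> 'v" where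
  "twisted_br \<beta> br 0 = br"
| "twisted_br \<beta> br (Suc n) = (\<lambda>x y. \<beta> (twisted_br \<beta> br n x y))"

primrec twisted_tr :: "('v \<Rightarrow> 'v) \<Rightarrow> ('v \<Rightarrow> 'v \<Rightarrow> 'v \<Rightarrow> 'v) \<Rightarrow> nat \<Rightarrow> 'v \<Rightarrow> 'v \<Rightarrow> 'v \<Rightarrow> 'v" where
  "twisted_tr \<beta> tr 0 = tr"
| "twisted_tr \<beta> tr (Suc n) = (\<lambda>x y z. (\<beta> ^^ 2) (twisted_tr \<beta> tr n x y z))"

end

theory Submission imports Defs begin

text \<open>The power \<open>\<gamma> = \<beta> ^^ n\<close> is again an even endomorphism, and the twisted brackets are
  \<open>\<gamma> [x, y]\<close> and \<open>\<gamma>\<^sup>2 [x, y, z]\<close>. Hence \<open>\<gamma> [\<gamma> [x, y], \<gamma> z] = \<gamma>\<^sup>2 [[x, y], z]\<close>, so the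
  Hom-Akivis identity is the image of the Akivis identity under \<open>\<gamma>\<^sup>2\<close>.\<close>

lemma twisted_br_eq_funpow: "twisted_br \<beta> br n x y = (\<beta> ^^ n) (br x y)"
  by (induction n) auto

text \<open>Applying \<open>\<beta> ^^ 2\<close> n times gives the power 2n of \<beta>. It splits
  into two copies of \<open>\<beta> ^^ n\<close> because \<beta> commutes with its own
  powers.\<close>

lemma twisted_tr_eq_funpow: "twisted_tr \<beta> tr n x y z = (\<beta> ^^ n) ((\<beta> ^^ n) (tr x y z))"
  by (induction n) (auto simp: numeral_2_eq_2 funpow_swap1)

context color_akivis_algebra
begin

lemma even_endomorphism_id: "even_endomorphism id"
  by (simp add: even_endomorphism_def even_linear_twist)

lemma even_endomorphism_comp:
  assumes "even_endomorphism f" "even_endomorphism g"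
  shows "even_endomorphism (f \<circ> g)"
  using assms unfolding even_endomorphism_def even_linear_def
  by (auto intro: Vector_Spaces.linear_compose)

lemma even_endomorphism_funpow:
  assumes "even_endomorphism f"
  shows "even_endomorphism (f ^^ n)"
  by (induction n) (simp_all only: funpow.simps assms even_endomorphism_id even_endomorphism_comp)

text \<open>Nested binary brackets collect \<gamma> twice, so the ternary bracket must carry
  \<gamma> twice to match. With \<gamma> arbitrary, a power of \<beta> can be inserted directly,
  with no passage through intermediate algebras whose twist may differ from
  \<open>id\<close>.\<close>

lemma multiplicative_twist:
  assumes "even_endomorphism \<gamma>"
  shows "multiplicative_color_hom_akivis_algebra scale V
    (\<lambda>x y. \<gamma> (br x y)) (\<lambda>x y z. \<gamma> (\<gamma> (tr x y z))) \<epsilon> \<gamma>"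
proof -
  \<comment> \<open>The equations \<open>br\<close> and \<open>tr\<close> are oriented so that
    rewriting pulls \<gamma> out of brackets.\<close>
  have lin: "Vector_Spaces.linear scale scale \<gamma>"
    and deg: "\<And>a x. x \<in> V a \<Longrightarrow> \<gamma> x \<in> V a"
    and br: "\<And>x y. br (\<gamma> x) (\<gamma> y) = \<gamma> (br x y)"
    and tr: "\<And>x y z. tr (\<gamma> x) (\<gamma> y) (\<gamma> z) = \<gamma> (tr x y z)"
    using assms by (auto simp: even_endomorphism_def even_linear_def)
  interpret \<gamma>: Vector_Spaces.linear scale scale \<gamma> by (rule lin)
  note push = \<gamma>.add \<gamma>.scale \<gamma>.neg \<gamma>.diff
  have lin_twist: "Vector_Spaces.linear scale scale (\<lambda>x. \<gamma> (f x))"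
    if "Vector_Spaces.linear scale scale f" for f
    using Vector_Spaces.linear_compose[OF that lin] by (simp add: o_def)
  show ?thesis
  proof unfold_locales
    show "even_bilinear (\<lambda>x y. \<gamma> (br x y))"
      using even_bilinear_br unfolding even_bilinear_def by (auto intro: lin_twist deg)
    show "even_trilinear (\<lambda>x y z. \<gamma> (\<gamma> (tr x y z)))"
      using even_trilinear_tr unfolding even_trilinear_def by (auto intro!: lin_twist deg)
    show "even_linear \<gamma>"
      using assms by (simp add: even_endomorphism_def)
  next
    fix x y a b assume "x \<in> V a" "y \<in> V b"
    then show "\<gamma> (br x y) = - (\<epsilon> a b *s \<gamma> (br y x))"
      using skew_symmetric[of x a y b] by (metis \<gamma>.neg \<gamma>.scale)
  next
    fix x y z a b c assume "x \<in> V a" "y \<in> V b" "z \<in> V c"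
    from arg_cong[OF hom_akivis_identity[OF this], of "\<lambda>x. \<gamma> (\<gamma> x)"]
    show "\<epsilon> c a *s \<gamma> (br (\<gamma> (br x y)) (\<gamma> z)) + \<epsilon> a b *s \<gamma> (br (\<gamma> (br y z)) (\<gamma> x))
        + \<epsilon> b c *s \<gamma> (br (\<gamma> (br z x)) (\<gamma> y))
      = \<epsilon> c a *s (\<gamma> (\<gamma> (tr x y z)) - \<epsilon> a b *s \<gamma> (\<gamma> (tr y x z)))
      + \<epsilon> a b *s (\<gamma> (\<gamma> (tr y z x)) - \<epsilon> b c *s \<gamma> (\<gamma> (tr z y x)))
      + \<epsilon> b c *s (\<gamma> (\<gamma> (tr z x y)) - \<epsilon> c a *s \<gamma> (\<gamma> (tr x z y)))"
      \<comment> \<open>In the image identity \<open>push\<close> carries \<gamma> through sums and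
        scalars up to the brackets; in the goal \<open>br\<close> pulls \<gamma> out of them. Both
        reach the same normal form.\<close>
      by (simp only: push br id_apply)
  \<comment> \<open>Multiplicativity remains: once \<gamma> is pulled out, both sides carry the same
    power of it.\<close>
  qed (simp_all only: br tr)
qed

end

theorem proposition3p1:
  fixes scale :: "'k::field_char_0 \<Rightarrow> 'v::ab_group_add \<Rightarrow> 'v"
    and V :: "'g::ab_group_add \<Rightarrow> 'v set"
    and br :: "'v \<Rightarrow> 'v \<Rightarrow> 'v"
    and tr :: "'v \<Rightarrow> 'v \<Rightarrow> 'v \<Rightarrow> 'v"
    and \<epsilon> :: "'g \<Rightarrow> 'g \<Rightarrow> 'k"
    and \<beta> :: "'v \<Rightarrow> 'v"
  assumes "color_akivis_algebra scale V br tr \<epsilon>"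
    and "color_akivis_algebra.even_endomorphism scale V br tr \<beta>"
  shows "\<forall>n\<ge>1. multiplicative_color_hom_akivis_algebra scale V
           (twisted_br \<beta> br n) (twisted_tr \<beta> tr n) \<epsilon> (\<beta> ^^ n)"
proof (intro allI impI)
  fix n :: nat
  interpret color_akivis_algebra scale V br tr \<epsilon> by (rule assms(1))
  show "multiplicative_color_hom_akivis_algebra scale V
           (twisted_br \<beta> br n) (twisted_tr \<beta> tr n) \<epsilon> (\<beta> ^^ n)"
    using multiplicative_twist[OF even_endomorphism_funpow[OF assms(2), of n]]
    \<comment> \<open>The locale takes the brackets as functions, so the pointwise closed forms are
      used as equations between functions.\<close>
    by (simp add: twisted_br_eq_funpow[abs_def] twisted_tr_eq_funpow[abs_def])
qed

end
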